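(* Let $\mathbb{H}$ be a complex Hilbert space, let $A\ne0$ be a positive bounded linear operator on $\mathbb{H}$, and let $\epsilon\in[0,1)$. Suppose $B_{\mathbb{H}(A)}\cap\overline{R(A)}$ is bounded with respect to $\|\cdot\|$. Let $T,S\in B_{A^{1/2}}(\mathbb{H})$ be compact operators. Then the following conditions are equivalent: (i) $T\bot_{\epsilon(A)}S$. (ii) For each $\theta\in[0,\pi)$ there exist $x_\theta,y_\theta\in S_{\mathbb{H}(A)}$ such that (a) $\|Tx_\theta\|_A=\|Ty_\theta\|_A=\|T\|_A$; (b) $\mathrm{Re}\big(e^{-i\theta}\langle Tx_\theta,Sx_\theta\rangle_A\big)\ge-\epsilon\|T\|_A\|S\|_A$; (c) $\mathrm{Re}\big(e^{-i\theta}\langle Ty_\theta,Sy_\theta\rangle_A\big)\le\epsilon\|T\|_A\|S\|_A$.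
   Context: $\|\cdot\|$ is the Hilbert space norm of $\mathbb{H}$; compactness is with respect to it. A bounded linear operator $A$ on $\mathbb{H}$ is positive if $A=A^*$ and $\langle Ax,x\rangle\ge0$ for all $x$; $R(A)$ is its range and the closure $\overline{R(A)}$ is in $\|\cdot\|$. Put $\langle x,y\rangle_A=\langle Ax,y\rangle$ (linear in the first argument), $\|x\|_A=\sqrt{\langle Ax,x\rangle}$, $B_{\mathbb{H}(A)}=\{x\in\mathbb{H}:\|x\|_A\le1\}$ and $S_{\mathbb{H}(A)}=\{x\in\mathbb{H}:\|x\|_A=1\}$. $B_{A^{1/2}}(\mathbb{H})$ is the set of $A$-bounded operators, i.e. bounded linear operators $T$ on $\mathbb{H}$ for which there is $c>0$ with $\|Tx\|_A\le c\|x\|_A$ for all $x\in\mathbb{H}$; for such $T$, $\|T\|_A=\sup\{\|Tx\|_A:\|x\|_A=1\}$. For $T,S\in B_{A^{1/2}}(\mathbb{H})$, $T\bot_{\epsilon(A)}S$ means $\|T+\lambda S\|_A^2\ge\|T\|_A^2-2\epsilon\|T\|_A\|\lambda S\|_A$ for all scalars $\lambda$. *)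

theory Defs
  imports "HOL-Analysis.Analysis"
begin

section \<open>Complex Hilbert spaces\<close>

text \<open>
  A complex inner product space is presented on top of its underlying real inner product space:
  the real scalar product is the real part of the complex one, so that the norm, the topology
  and positive definiteness are those of class \<open>real_inner\<close>. The complex inner product is linear
  in the \<^emph>\<open>first\<close> argument.
\<close>

class complex_inner = real_inner +
  fixes scaleC :: "complex \<Rightarrow> 'a \<Rightarrow> 'a" (infixr \<open>*\<^sub>C\<close> 75)
    and cinner :: "'a \<Rightarrow> 'a \<Rightarrow> complex"
  assumes scaleC_add_right: "c *\<^sub>C (x + y) = c *\<^sub>C x + c *\<^sub>C y"
    and scaleC_add_left: "(c + d) *\<^sub>C x = c *\<^sub>C x + d *\<^sub>C x"
    and scaleC_scaleC: "c *\<^sub>C d *\<^sub>C x = (c * d) *\<^sub>C x"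
    and scaleR_scaleC: "r *\<^sub>R x = complex_of_real r *\<^sub>C x"
    and cinner_commute: "cinner x y = cnj (cinner y x)"
    and cinner_add_left: "cinner (x + y) z = cinner x z + cinner y z"
    and cinner_scaleC_left: "cinner (c *\<^sub>C x) y = c * cinner x y"
    and inner_eq_Re_cinner: "inner x y = Re (cinner x y)"

class chilbert_space = complex_inner + complete_space

lemma cinner_add_right: "cinner x (y + z) = cinner x y + cinner x z"
  by (metis cinner_add_left cinner_commute complex_cnj_add)

lemma cinner_scaleC_right: "cinner x (c *\<^sub>C y) = cnj c * cinner x y"
  by (metis cinner_commute cinner_scaleC_left complex_cnj_mult)

lemma cinner_self: "cinner x x = complex_of_real ((norm x)\<^sup>2)"
proof (rule complex_eqI)
  show "Re (cinner x x) = Re (complex_of_real ((norm x)\<^sup>2))"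
    by (simp add: power2_norm_eq_inner inner_eq_Re_cinner)
  have "Im (cinner x x) = - Im (cinner x x)"
    by (metis cinner_commute cnj.simps(2))
  then show "Im (cinner x x) = Im (complex_of_real ((norm x)\<^sup>2))" by simp
qed

lemma cinner_eqI:
  fixes y z :: "'a::complex_inner"
  assumes "\<And>x. cinner x y = cinner x z"
  shows "y = z"
proof -
  have "inner x y = inner x z" for x by (simp add: inner_eq_Re_cinner assms)
  from this[of "y - z"] have "inner (y - z) (y - z) = 0" by (simp add: inner_diff_right)
  then show ?thesis by simp
qed

instantiation complex :: chilbert_space
begin

definition scaleC_complex :: "complex \<Rightarrow> complex \<Rightarrow> complex"
  where "scaleC_complex c x = c * x"

definition cinner_complex :: "complex \<Rightarrow> complex \<Rightarrow> complex"
  where "cinner_complex x y = x * cnj y"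

instance
  by standard
    (simp_all add: scaleC_complex_def cinner_complex_def algebra_simps inner_complex_def
      scaleR_conv_of_real)

end


section \<open>Operators\<close>

definition bounded_clinear :: "('a::complex_inner \<Rightarrow> 'b::complex_inner) \<Rightarrow> bool"
  where "bounded_clinear T \<longleftrightarrow> bounded_linear T \<and> (\<forall>c x. T (c *\<^sub>C x) = c *\<^sub>C T x)"

definition compact_operator :: "('a::complex_inner \<Rightarrow> 'b::complex_inner) \<Rightarrow> bool"
  where "compact_operator T \<longleftrightarrow>
    bounded_clinear T \<and> (\<forall>X. bounded X \<longrightarrow> compact (closure (T ` X)))"

text \<open>The Hilbert space adjoint, in the style of \<open>adjoint\<close> for real inner product spaces.\<close>

definition cadjoint :: "('a::complex_inner \<Rightarrow> 'b::complex_inner) \<Rightarrow> 'b \<Rightarrow> 'a"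
  where "cadjoint T = (SOME T'. \<forall>x y. cinner (T x) y = cinner x (T' y))"

lemma cadjoint_unique:
  assumes "\<And>x y. cinner (T x) y = cinner x (T' y)"
  shows "cadjoint T = T'"
  unfolding cadjoint_def
proof (rule some_equality)
  show "\<forall>x y. cinner (T x) y = cinner x (T' y)" using assms by simp
  show "U = T'" if "\<forall>x y. cinner (T x) y = cinner x (U y)" for U
  proof
    show "U y = T' y" for y
      by (rule cinner_eqI) (metis assms that)
  qed
qed

definition positive_operator :: "('a::complex_inner \<Rightarrow> 'a) \<Rightarrow> bool"
  where "positive_operator A \<longleftrightarrow>
    bounded_clinear A \<and> A = cadjoint A \<and> (\<forall>x. cinner (A x) x \<in> \<real>\<^sub>\<ge>\<^sub>0)"

lemma positive_operator_symmetric: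
  assumes "positive_operator A"
  shows "cinner (A x) y = cinner x (A y)"
proof -
  have add: "A (u + v) = A u + A v" and scale: "A (c *\<^sub>C u) = c *\<^sub>C A u" for u v c
    using assms
    by (auto simp: positive_operator_def bounded_clinear_def linear_add bounded_linear.linear)
  have real: "Im (cinner (A u) u) = 0" for u
    using assms by (auto simp: positive_operator_def complex_nonneg_Reals_iff)
  have "Im (cinner (A x) y) + Im (cinner (A y) x) = 0"
    using real[of "x + y"] real[of x] real[of y]
    by (simp add: add cinner_add_left cinner_add_right)
  moreover have "Re (cinner (A y) x) - Re (cinner (A x) y) = 0"
    using real[of "x + \<i> *\<^sub>C y"] real[of x] real[of y]
    by (simp add: add scale cinner_add_left cinner_add_right cinner_scaleC_left cinner_scaleC_right)
  ultimately have "cinner (A x) y = cnj (cinner (A y) x)"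
    by (simp add: complex_eq_iff)
  then show ?thesis by (metis cinner_commute)
qed

lemma positive_operator_iff:
  "positive_operator A \<longleftrightarrow>
    bounded_clinear A \<and> (\<forall>x y. cinner (A x) y = cinner x (A y)) \<and> (\<forall>x. cinner (A x) x \<in> \<real>\<^sub>\<ge>\<^sub>0)"
proof
  assume "positive_operator A"
  then show "bounded_clinear A \<and> (\<forall>x y. cinner (A x) y = cinner x (A y)) \<and>
      (\<forall>x. cinner (A x) x \<in> \<real>\<^sub>\<ge>\<^sub>0)"
    using positive_operator_symmetric by (auto simp: positive_operator_def)
next
  assume *: "bounded_clinear A \<and> (\<forall>x y. cinner (A x) y = cinner x (A y)) \<and>
      (\<forall>x. cinner (A x) x \<in> \<real>\<^sub>\<ge>\<^sub>0)"
  then have "cadjoint A = A" by (intro cadjoint_unique) blast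
  with * show "positive_operator A" unfolding positive_operator_def by metis
qed


section \<open>The semi-inner product induced by an operator\<close>

definition cinner_wrt :: "('a::complex_inner \<Rightarrow> 'a) \<Rightarrow> 'a \<Rightarrow> 'a \<Rightarrow> complex"
  where "cinner_wrt A x y = cinner (A x) y"

text \<open>For positive \<open>A\<close> the value \<open>cinner_wrt A x x\<close> is real and nonnegative.\<close>

definition norm_wrt :: "('a::complex_inner \<Rightarrow> 'a) \<Rightarrow> 'a \<Rightarrow> real"
  where "norm_wrt A x = sqrt (Re (cinner_wrt A x x))"

definition unit_ball_wrt :: "('a::complex_inner \<Rightarrow> 'a) \<Rightarrow> 'a set"
  where "unit_ball_wrt A = {x. norm_wrt A x \<le> 1}"

definition unit_sphere_wrt :: "('a::complex_inner \<Rightarrow> 'a) \<Rightarrow> 'a set"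
  where "unit_sphere_wrt A = {x. norm_wrt A x = 1}"

definition bounded_operators_wrt :: "('a::complex_inner \<Rightarrow> 'a) \<Rightarrow> ('a \<Rightarrow> 'a) set"
  where "bounded_operators_wrt A =
    {T. bounded_clinear T \<and> (\<exists>c>0. \<forall>x. norm_wrt A (T x) \<le> c * norm_wrt A x)}"

text \<open>
  For positive \<open>A \<noteq> 0\<close> and \<open>T \<in> bounded_operators_wrt A\<close> the supremum is over a nonempty set
  that is bounded above.
\<close>

definition opnorm_wrt :: "('a::complex_inner \<Rightarrow> 'a) \<Rightarrow> ('a \<Rightarrow> 'a) \<Rightarrow> real"
  where "opnorm_wrt A T = Sup {norm_wrt A (T x) | x. norm_wrt A x = 1}"

definition approx_orthogonal_wrt ::
    "('a::complex_inner \<Rightarrow> 'a) \<Rightarrow> real \<Rightarrow> ('a \<Rightarrow> 'a) \<Rightarrow> ('a \<Rightarrow> 'a) \<Rightarrow> bool"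
  where "approx_orthogonal_wrt A \<epsilon> T S \<longleftrightarrow>
    (\<forall>c::complex. (opnorm_wrt A (\<lambda>x. T x + c *\<^sub>C S x))\<^sup>2 \<ge>
      (opnorm_wrt A T)\<^sup>2 - 2 * \<epsilon> * opnorm_wrt A T * opnorm_wrt A (\<lambda>x. c *\<^sub>C S x))"

end

theory Submission
  imports Defs
begin

text \<open>
  For (ii) \<open>\<Longrightarrow>\<close> (i), evaluate \<open>T + c S\<close> at the vector that (ii) gives for the argument of \<open>c\<close>,
  reduced modulo \<open>\<pi>\<close>. For (i) \<open>\<Longrightarrow>\<close> (ii), fix \<open>\<theta>\<close> and choose near-maximizers \<open>x\<^sub>t\<close> of
  \<open>T + t e\<^sup>i\<^sup>\<theta> S\<close> on the unit sphere. Expanding the square gives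
  \<open>Re (e\<^sup>-\<^sup>i\<^sup>\<theta> \<langle>T x\<^sub>t, S x\<^sub>t\<rangle>\<^sub>A) \<ge> - \<epsilon> \<parallel>T\<parallel>\<^sub>A \<parallel>S\<parallel>\<^sub>A - O(t)\<close> and shows that \<open>x\<^sub>t\<close> is a maximizing family for \<open>T\<close>.
  By orthogonal projection \<open>x\<^sub>t\<close> may be taken in the closure of the range of \<open>A\<close>, where the boundedness
  hypothesis makes the seminorm equivalent to the norm, so that a subsequence converges and its
  limit is \<open>x\<^sub>\<theta>\<close>. The vector \<open>y\<^sub>\<theta>\<close> comes from \<open>\<theta> + \<pi>\<close>.
\<close>

section \<open>Discriminants, Cauchy sequences and orthogonal projection\<close>

lemma quadratic_nonneg_imp:
  fixes a q r :: real
  assumes "\<And>t. 0 \<le> a + 2 * t * q + t\<^sup>2 * r" "0 \<le> r"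
  shows "q\<^sup>2 \<le> a * r"
proof (cases "r = 0")
  case True
  have "q = 0"
  proof (rule ccontr)
    assume "q \<noteq> 0"
    \<comment> \<open>At this argument the affine function \<open>a + 2 * t * q\<close> takes the
      value -1.\<close>
    then have "2 * (- (a + 1) / (2 * q)) * q = - (a + 1)" by simp
    then show False using assms(1)[of "- (a + 1) / (2 * q)"] unfolding True by linarith
  qed
  then show ?thesis using True by simp
next
  case False
  then have r: "r > 0" using assms(2) by simp
  have "2 * (- q / r) * q = - 2 * (q\<^sup>2 / r)" "(- q / r)\<^sup>2 * r = q\<^sup>2 / r"
    using r by (simp_all add: power2_eq_square)
  then have "q\<^sup>2 / r \<le> a" using assms(1)[of "- q / r"] by linarith
  then show ?thesis using r by (simp add: field_simps)
qed

text \<open>Parallelogram estimates split into one error per index. This lemma turns them into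
  Cauchy sequences, once for the nearest point of a closed subspace and once for a maximizing
  sequence of an operator.\<close>

lemma Cauchy_if_dist_sq_le:
  fixes f :: "nat \<Rightarrow> 'a::metric_space"
  assumes "\<And>n k. (dist (f n) (f k))\<^sup>2 \<le> b n + b k" "b \<longlonglongrightarrow> 0"
  shows "Cauchy f"
proof (rule metric_CauchyI)
  fix e :: real assume e: "e > 0"
  then have "e\<^sup>2 / 2 > 0" by simp
  then obtain N where N: "\<And>n. n \<ge> N \<Longrightarrow> b n < e\<^sup>2 / 2"
    using order_tendstoD(2)[OF assms(2)] unfolding eventually_sequentially by blast
  have "dist (f n) (f k) < e" if "n \<ge> N" "k \<ge> N" for n k
  proof (rule power2_less_imp_less)
    show "(dist (f n) (f k))\<^sup>2 < e\<^sup>2" using assms(1)[of n k] N[of n] N[of k] that by linarith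
  qed (use e in simp)
  then show "\<exists>N. \<forall>m\<ge>N. \<forall>n\<ge>N. dist (f m) (f n) < e" by blast
qed

lemma subspace_closure:
  fixes M :: "'a::real_normed_vector set"
  assumes "subspace M"
  shows "subspace (closure M)"
proof (rule subspaceI)
  show "0 \<in> closure M" using subspace_0[OF assms] closure_subset by blast
next
  fix x y assume "x \<in> closure M" "y \<in> closure M"
  then obtain f g where "\<And>n. f n \<in> M" "f \<longlonglongrightarrow> x" "\<And>n. g n \<in> M" "g \<longlonglongrightarrow> y"
    unfolding closure_sequential by blast
  then show "x + y \<in> closure M" unfolding closure_sequential
    by (intro exI[of _ "\<lambda>n. f n + g n"] conjI allI subspace_add[OF assms] tendsto_add)
next
  fix c x assume "x \<in> closure M"
  then obtain f where "\<And>n. f n \<in> M" "f \<longlonglongrightarrow> x"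
    unfolding closure_sequential by blast
  then show "c *\<^sub>R x \<in> closure M" unfolding closure_sequential
    by (intro exI[of _ "\<lambda>n. c *\<^sub>R f n"] conjI allI subspace_scale[OF assms] tendsto_intros)
qed

text \<open>\<open>m\<close> is the point of \<open>M\<close> nearest to \<open>z\<close>: a
  minimizing sequence is Cauchy by the parallelogram law, completeness gives its limit, and
  minimality along every direction of \<open>M\<close> is orthogonality.\<close>

lemma orthogonal_decomposition_exists:
  fixes M :: "'a::{real_inner,complete_space} set"
  assumes "subspace M" "closed M"
  obtains m where "m \<in> M" "\<And>y. y \<in> M \<Longrightarrow> inner (z - m) y = 0"
proof -
  define d where "d = (INF m\<in>M. (norm (z - m))\<^sup>2)"
  have ne: "M \<noteq> {}" using assms(1) subspace_0 by blast
  have bdd: "bdd_below ((\<lambda>m. (norm (z - m))\<^sup>2) ` M)" by (rule bdd_belowI[of _ 0]) auto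
  have d_le: "d \<le> (norm (z - m))\<^sup>2" if "m \<in> M" for m
    unfolding d_def using bdd that by (rule cINF_lower)
  have "\<exists>m\<in>M. (norm (z - m))\<^sup>2 < d + inverse (real (Suc n))" for n
    using cINF_less_iff[OF ne bdd, of "d + inverse (real (Suc n))"] by (auto simp: d_def)
  then obtain f where f: "\<And>n. f n \<in> M" "\<And>n. (norm (z - f n))\<^sup>2 < d + inverse (real (Suc n))"
    by metis
  have dist: "(norm (f n - f k))\<^sup>2 \<le> 2 * inverse (real (Suc n)) + 2 * inverse (real (Suc k))" for n k
  proof -
    \<comment> \<open>The midpoint lies in \<open>M\<close>, so its squared distance from
      \<open>z\<close> is at least \<open>d\<close>. In the parallelogram law for
      \<open>z - f n\<close> and \<open>z - f k\<close> only the excesses over \<open>d\<close> then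
      remain.\<close>
    have "(1/2) *\<^sub>R (f n + f k) \<in> M"
      using f assms(1) by (intro subspace_scale subspace_add)
    from d_le[OF this] have "4 * d \<le> (2 * norm (z - (1/2) *\<^sub>R (f n + f k)))\<^sup>2"
      by (simp add: power_mult_distrib)
    also have "2 * norm (z - (1/2) *\<^sub>R (f n + f k)) = norm (2 *\<^sub>R (z - (1/2) *\<^sub>R (f n + f k)))"
      by simp
    also have "2 *\<^sub>R (z - (1/2) *\<^sub>R (f n + f k)) = (z - f n) + (z - f k)"
      by (simp add: algebra_simps scaleR_2)
    also have "(norm ((z - f n) + (z - f k)))\<^sup>2
        = 2 * (norm (z - f n))\<^sup>2 + 2 * (norm (z - f k))\<^sup>2 - (norm ((z - f n) - (z - f k)))\<^sup>2"
      by (simp add: power2_norm_eq_inner inner_add_left inner_add_right inner_diff_left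
          inner_diff_right inner_commute algebra_simps)
    finally show ?thesis using f(2)[of n] f(2)[of k]
      by (simp add: norm_minus_commute)
  qed
  have "(\<lambda>n. 2 * inverse (real (Suc n))) \<longlonglongrightarrow> 0"
    using tendsto_mult_right_zero[OF LIMSEQ_inverse_real_of_nat] .
  with dist have "Cauchy f" unfolding dist_norm[symmetric] by (rule Cauchy_if_dist_sq_le)
  then obtain m where m: "f \<longlonglongrightarrow> m" using Cauchy_convergent_iff convergent_def by blast
  have mM: "m \<in> M" using assms(2) f(1) m closed_sequentially by blast
  have "(\<lambda>n. d + inverse (real (Suc n)) - (norm (z - f n))\<^sup>2) \<longlonglongrightarrow> d + 0 - (norm (z - m))\<^sup>2"
    by (intro tendsto_intros m LIMSEQ_inverse_real_of_nat)
  then have md: "(norm (z - m))\<^sup>2 \<le> d"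
    using LIMSEQ_le_const[of _ _ 0] f(2) by (fastforce intro: less_imp_le)
  have "inner (z - m) y = 0" if y: "y \<in> M" for y
  proof -
    \<comment> \<open>Moving \<open>m\<close> by a multiple of \<open>y\<close> stays in
      \<open>M\<close> and cannot come closer to \<open>z\<close>. A nonnegative quadratic without
      constant term has no linear term either.\<close>
    have q: "0 \<le> t\<^sup>2 * (norm y)\<^sup>2 - 2 * t * inner (z - m) y" for t
    proof -
      have "m + t *\<^sub>R y \<in> M" using mM y assms(1) by (intro subspace_scale subspace_add)
      from d_le[OF this] md have "(norm (z - m))\<^sup>2 \<le> (norm ((z - m) - t *\<^sub>R y))\<^sup>2"
        by (metis diff_diff_eq order_trans)
      also have "\<dots> = (norm (z - m))\<^sup>2 + (t\<^sup>2 * (norm y)\<^sup>2 - 2 * t * inner (z - m) y)"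
        unfolding power2_norm_eq_inner inner_diff_left inner_diff_right
        by (simp add: inner_commute power2_eq_square algebra_simps)
      finally show ?thesis by simp
    qed
    show ?thesis using quadratic_nonneg_imp[of 0 "- inner (z - m) y" "(norm y)\<^sup>2"] q
      by (simp add: algebra_simps)
  qed
  with mM show thesis by (rule that)
qed

section \<open>Complex scalars and the norm\<close>

lemma inner_scaleC_scaleC:
  fixes x y :: "'a::complex_inner"
  shows "inner (c *\<^sub>C x) (c *\<^sub>C y) = (cmod c)\<^sup>2 * inner x y"
proof -
  have "cinner (c *\<^sub>C x) (c *\<^sub>C y) = complex_of_real ((cmod c)\<^sup>2) * cinner x y"
    unfolding cinner_scaleC_left cinner_scaleC_right complex_norm_square by (simp only: mult_ac)
  then show ?thesis by (simp add: inner_eq_Re_cinner del: of_real_power)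
qed

lemma norm_scaleC: "norm (c *\<^sub>C x) = cmod c * norm (x::'a::complex_inner)"
proof -
  have "(norm (c *\<^sub>C x))\<^sup>2 = (cmod c * norm x)\<^sup>2"
    by (simp add: power2_norm_eq_inner inner_scaleC_scaleC power_mult_distrib)
  then show ?thesis by (simp add: power2_eq_iff_nonneg)
qed

lemma bounded_linear_scaleC: "bounded_linear (\<lambda>x::'a::complex_inner. c *\<^sub>C x)"
  by (rule bounded_linear_intro[where K = "cmod c"])
    (simp_all add: scaleC_add_right scaleR_scaleC scaleC_scaleC mult.commute norm_scaleC)

section \<open>The seminorm of a positive operator\<close>

locale positive_op =
  fixes A :: "'a::chilbert_space \<Rightarrow> 'a"
  assumes positive: "positive_operator A"
begin

lemma bounded_linear: "bounded_linear A"
  and scaleC: "A (c *\<^sub>C x) = c *\<^sub>C A x"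
  using positive by (auto simp: positive_operator_def bounded_clinear_def)

sublocale bounded_linear A by (rule bounded_linear)

lemma inner_sym: "inner (A x) y = inner x (A y)"
  by (simp add: inner_eq_Re_cinner positive_operator_symmetric[OF positive])

lemma inner_swap: "inner (A x) y = inner (A y) x"
  by (metis inner_sym inner_commute)

lemma inner_nonneg: "0 \<le> inner (A x) x"
  using positive by (auto simp: positive_operator_def inner_eq_Re_cinner complex_nonneg_Reals_iff)

lemma norm_wrt_nonneg [simp]: "0 \<le> norm_wrt A x"
  using inner_nonneg by (simp add: norm_wrt_def cinner_wrt_def flip: inner_eq_Re_cinner)

lemma norm_wrt_sq: "(norm_wrt A x)\<^sup>2 = inner (A x) x"
  using inner_nonneg by (simp add: norm_wrt_def cinner_wrt_def flip: inner_eq_Re_cinner)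

lemma norm_wrt_scaleC: "norm_wrt A (c *\<^sub>C x) = cmod c * norm_wrt A x"
proof -
  have "(norm_wrt A (c *\<^sub>C x))\<^sup>2 = (cmod c * norm_wrt A x)\<^sup>2"
    by (simp add: norm_wrt_sq scaleC inner_scaleC_scaleC power_mult_distrib)
  then show ?thesis by (simp add: power2_eq_iff_nonneg)
qed

lemma norm_wrt_scaleR: "norm_wrt A (r *\<^sub>R x) = \<bar>r\<bar> * norm_wrt A x"
  by (simp add: scaleR_scaleC norm_wrt_scaleC)

text \<open>The cross term is the real part of the A-product, so expansions of squared seminorms are
  carried out with the real form \<open>inner (A x) y\<close>.\<close>

lemma norm_wrt_add_sq:
  "(norm_wrt A (x + y))\<^sup>2 = (norm_wrt A x)\<^sup>2 + 2 * inner (A x) y + (norm_wrt A y)\<^sup>2"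
  by (simp add: norm_wrt_sq add inner_add_left inner_add_right inner_swap[of y x])

lemma norm_wrt_diff_sq:
  "(norm_wrt A (x - y))\<^sup>2 = (norm_wrt A x)\<^sup>2 - 2 * inner (A x) y + (norm_wrt A y)\<^sup>2"
  by (simp add: norm_wrt_sq diff inner_diff_left inner_diff_right inner_swap[of y x])

lemma Cauchy_Schwarz_wrt: "\<bar>inner (A x) y\<bar> \<le> norm_wrt A x * norm_wrt A y"
proof -
  let ?q = "inner (A x) y"
  have quad: "0 \<le> (norm_wrt A x)\<^sup>2 + 2 * t * ?q + t\<^sup>2 * (norm_wrt A y)\<^sup>2" for t
    using zero_le_power2[of "norm_wrt A (x + t *\<^sub>R y)"]
    by (simp add: norm_wrt_add_sq norm_wrt_scaleR power_mult_distrib)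
  have "?q\<^sup>2 \<le> (norm_wrt A x)\<^sup>2 * (norm_wrt A y)\<^sup>2"
    using quad by (intro quadratic_nonneg_imp) auto
  then have "\<bar>?q\<bar>\<^sup>2 \<le> (norm_wrt A x * norm_wrt A y)\<^sup>2" by (simp add: power_mult_distrib)
  then show ?thesis by (rule power2_le_imp_le) simp
qed

lemma norm_wrt_triangle: "norm_wrt A (x + y) \<le> norm_wrt A x + norm_wrt A y"
proof (rule power2_le_imp_le)
  show "(norm_wrt A (x + y))\<^sup>2 \<le> (norm_wrt A x + norm_wrt A y)\<^sup>2"
    using Cauchy_Schwarz_wrt[of x y] by (simp add: norm_wrt_add_sq power2_sum)
qed simp

text \<open>Cauchy-Schwarz against the vector \<open>A x\<close> turns a vanishing seminorm into a
  vanishing \<open>inner (A x) (A x)\<close>.\<close>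

lemma norm_wrt_eq_0_iff: "norm_wrt A x = 0 \<longleftrightarrow> A x = 0"
proof
  assume "norm_wrt A x = 0"
  then have "inner (A x) (A x) \<le> 0" using Cauchy_Schwarz_wrt[of x "A x"] by simp
  then show "A x = 0" by (metis inner_eq_zero_iff inner_ge_zero order_antisym)
next
  assume "A x = 0"
  then show "norm_wrt A x = 0" using norm_wrt_sq[of x] by simp
qed

text \<open>By self-adjointness \<open>inner (A x) x\<close> depends only on \<open>A x\<close>;
  hence a vector may be replaced by its projection onto the closure of the range.\<close>

lemma norm_wrt_cong: "A x = A y \<Longrightarrow> norm_wrt A x = norm_wrt A y"
  by (metis inner_sym norm_wrt_sq norm_wrt_nonneg power2_eq_iff_nonneg)

text \<open>Ensures that the supremum in \<open>opnorm_wrt\<close> is over a nonempty set.\<close>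

lemma unit_vector_exists:
  assumes "A \<noteq> (\<lambda>x. 0)"
  obtains x where "norm_wrt A x = 1"
proof -
  obtain z where "norm_wrt A z \<noteq> 0" using assms norm_wrt_eq_0_iff by fastforce
  then have "norm_wrt A (inverse (norm_wrt A z) *\<^sub>R z) = 1" by (simp add: norm_wrt_scaleR)
  then show thesis by (rule that)
qed

section \<open>The operator seminorm\<close>

text \<open>\<open>C\<close> only guarantees that the supremum is over a set bounded above.
  \<open>P\<close> is an arbitrary map, so that sums T + c S can be inserted directly.\<close>

lemma opnorm_wrt_upper:
  assumes "\<And>x. norm_wrt A x = 1 \<Longrightarrow> norm_wrt A (P x) \<le> C" "norm_wrt A x = 1"
  shows "norm_wrt A (P x) \<le> opnorm_wrt A P"
  unfolding opnorm_wrt_def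
  using assms by (intro cSup_upper bdd_aboveI[of _ C]) auto

lemma opnorm_wrt_least:
  assumes "A \<noteq> (\<lambda>x. 0)" "\<And>x. norm_wrt A x = 1 \<Longrightarrow> norm_wrt A (P x) \<le> C"
  shows "opnorm_wrt A P \<le> C"
  unfolding opnorm_wrt_def
proof (rule cSup_least)
  show "{norm_wrt A (P x) |x. norm_wrt A x = 1} \<noteq> {}"
    using unit_vector_exists[OF assms(1)] by blast
qed (use assms(2) in auto)

lemma bounded_operators_wrtD:
  assumes "T \<in> bounded_operators_wrt A"
  shows "bounded_linear T" "T (c *\<^sub>C x) = c *\<^sub>C T x"
    "\<exists>C. \<forall>x. norm_wrt A (T x) \<le> C * norm_wrt A x"
  using assms by (auto simp: bounded_operators_wrt_def bounded_clinear_def)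

text \<open>Vectors of nonzero seminorm are scaled to the unit sphere; for the others A-boundedness
  forces \<open>norm_wrt A (T x)\<close> to vanish.\<close>

lemma norm_wrt_le_opnorm:
  assumes "T \<in> bounded_operators_wrt A"
  shows "norm_wrt A (T x) \<le> opnorm_wrt A T * norm_wrt A x"
proof -
  obtain C where C: "\<And>x. norm_wrt A (T x) \<le> C * norm_wrt A x"
    using bounded_operators_wrtD(3)[OF assms] by blast
  show ?thesis
  proof (cases "norm_wrt A x = 0")
    case True
    then show ?thesis using C[of x] by simp
  next
    case False
    let ?u = "inverse (norm_wrt A x) *\<^sub>R x"
    have "norm_wrt A (T ?u) \<le> opnorm_wrt A T"
    proof (rule opnorm_wrt_upper)
      show "norm_wrt A (T y) \<le> C" if "norm_wrt A y = 1" for y using C[of y] that by simp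
      show "norm_wrt A ?u = 1" using False by (simp add: norm_wrt_scaleR)
    qed
    then show ?thesis using False
      by (simp add: linear_scale[OF bounded_linear.linear[OF bounded_operators_wrtD(1)[OF assms]]]
          norm_wrt_scaleR divide_simps mult.commute less_le)
  qed
qed

lemma norm_wrt_le_opnorm_unit:
  assumes "T \<in> bounded_operators_wrt A" "norm_wrt A x = 1"
  shows "norm_wrt A (T x) \<le> opnorm_wrt A T"
  using norm_wrt_le_opnorm[OF assms(1), of x] assms(2) by simp

lemma opnorm_wrt_nonneg:
  assumes "A \<noteq> (\<lambda>x. 0)" "T \<in> bounded_operators_wrt A"
  shows "0 \<le> opnorm_wrt A T"
  using unit_vector_exists[OF assms(1)] norm_wrt_le_opnorm_unit[OF assms(2)]
    norm_wrt_nonneg order_trans by metis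

lemma norm_wrt_scaleC_le_opnorm:
  assumes "S \<in> bounded_operators_wrt A" "norm_wrt A x = 1"
  shows "norm_wrt A (c *\<^sub>C S x) \<le> cmod c * opnorm_wrt A S"
  using norm_wrt_le_opnorm_unit[OF assms] by (simp add: norm_wrt_scaleC mult_left_mono)

lemma opnorm_wrt_scaleC:
  assumes "A \<noteq> (\<lambda>x. 0)" "S \<in> bounded_operators_wrt A"
  shows "opnorm_wrt A (\<lambda>x. c *\<^sub>C S x) = cmod c * opnorm_wrt A S"
proof (rule antisym)
  show "opnorm_wrt A (\<lambda>x. c *\<^sub>C S x) \<le> cmod c * opnorm_wrt A S"
    by (intro opnorm_wrt_least assms norm_wrt_scaleC_le_opnorm)
  have upper: "cmod c * norm_wrt A (S x) \<le> opnorm_wrt A (\<lambda>x. c *\<^sub>C S x)" if "norm_wrt A x = 1" for x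
    using opnorm_wrt_upper[of "\<lambda>x. c *\<^sub>C S x", OF norm_wrt_scaleC_le_opnorm[OF assms(2)] that]
    by (simp add: norm_wrt_scaleC)
  show "cmod c * opnorm_wrt A S \<le> opnorm_wrt A (\<lambda>x. c *\<^sub>C S x)"
  proof (cases "c = 0")
    case True
    obtain x where "norm_wrt A x = 1" using unit_vector_exists[OF assms(1)] .
    from upper[OF this] True show ?thesis by simp
  next
    case False
    then have "opnorm_wrt A S \<le> opnorm_wrt A (\<lambda>x. c *\<^sub>C S x) / cmod c"
      using upper by (intro opnorm_wrt_least assms) (simp add: field_simps)
    then show ?thesis using False by (simp add: field_simps)
  qed
qed

lemma norm_wrt_le_opnorm_add_scaleC:
  assumes "T \<in> bounded_operators_wrt A" "S \<in> bounded_operators_wrt A" "norm_wrt A x = 1"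
  shows "norm_wrt A (T x + c *\<^sub>C S x) \<le> opnorm_wrt A (\<lambda>x. T x + c *\<^sub>C S x)"
proof (rule opnorm_wrt_upper[of "\<lambda>x. T x + c *\<^sub>C S x", OF _ assms(3)])
  fix x assume "norm_wrt A x = 1"
  then show "norm_wrt A (T x + c *\<^sub>C S x) \<le> opnorm_wrt A T + cmod c * opnorm_wrt A S"
    using norm_wrt_triangle[of "T x" "c *\<^sub>C S x"] norm_wrt_le_opnorm_unit[OF assms(1)]
      norm_wrt_scaleC_le_opnorm[OF assms(2)] by (meson add_mono order_trans)
qed

text \<open>\<open>q\<close> is nonnegative because it dominates a square at some unit vector, so
  the bound passes through \<open>sqrt\<close>. Read contrapositively, this supplies
  near-maximizers.\<close>

lemma opnorm_wrt_sq_least: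
  assumes "A \<noteq> (\<lambda>x. 0)" "\<And>x. norm_wrt A x = 1 \<Longrightarrow> (norm_wrt A (P x))\<^sup>2 \<le> q" "0 \<le> opnorm_wrt A P"
  shows "(opnorm_wrt A P)\<^sup>2 \<le> q"
proof -
  obtain x where "norm_wrt A x = 1" using unit_vector_exists[OF assms(1)] .
  with assms(2) have q: "0 \<le> q" using zero_le_power2 order_trans by metis
  have "opnorm_wrt A P \<le> sqrt q"
    by (intro opnorm_wrt_least assms real_le_rsqrt)
  then show ?thesis using q assms(3) by (metis power_mono real_sqrt_pow2)
qed

section \<open>Reduction to the closure of the range\<close>

lemma subspace_closure_range: "subspace (closure (range A))"
  using subspace_closure linear_subspace_image[OF linear_axioms] subspace_UNIV by blast

text \<open>\<open>m\<close> is the projection of \<open>z\<close>. The difference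
  \<open>z - m\<close> is orthogonal to \<open>A (A (z - m))\<close>, and moving one
  \<open>A\<close> across the product gives \<open>A (z - m) = 0\<close>.\<close>

lemma range_component_exists:
  obtains m where "m \<in> closure (range A)" "A m = A z"
proof -
  obtain m where m: "m \<in> closure (range A)"
    "\<And>y. y \<in> closure (range A) \<Longrightarrow> inner (z - m) y = 0"
    using orthogonal_decomposition_exists[OF subspace_closure_range closed_closure] by blast
  have "A (A (z - m)) \<in> closure (range A)" by (rule subsetD[OF closure_subset rangeI])
  from m(2)[OF this] have "inner (A (z - m)) (A (z - m)) = 0" by (rule trans[OF inner_sym])
  then have "A m = A z" by (simp add: diff)
  with m(1) show thesis by (rule that)
qed

text \<open>An A-bounded operator preserves the null space of the seminorm, which is the kernel of
  \<open>A\<close>.\<close>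

lemma A_image_cong:
  assumes "T \<in> bounded_operators_wrt A" "A x = A y"
  shows "A (T x) = A (T y)"
proof -
  have "norm_wrt A (x - y) = 0" using assms(2) by (simp add: norm_wrt_eq_0_iff diff)
  then have "norm_wrt A (T (x - y)) \<le> 0" using norm_wrt_le_opnorm[OF assms(1), of "x - y"] by simp
  then have "A (T (x - y)) = 0" using norm_wrt_nonneg norm_wrt_eq_0_iff order_antisym by metis
  then show ?thesis
    by (simp add: linear_diff[OF bounded_linear.linear[OF bounded_operators_wrtD(1)[OF assms(1)]]] diff)
qed

text \<open>The boundedness hypothesis is used through this estimate, obtained by scaling into the
  unit ball of the seminorm.\<close>

lemma norm_le_norm_wrt:
  assumes "bounded (unit_ball_wrt A \<inter> closure (range A))"
  obtains K where "\<And>x. x \<in> closure (range A) \<Longrightarrow> norm x \<le> K * norm_wrt A x"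
proof -
  obtain K where K: "\<And>x. norm_wrt A x \<le> 1 \<Longrightarrow> x \<in> closure (range A) \<Longrightarrow> norm x \<le> K"
    using assms by (auto simp: bounded_iff unit_ball_wrt_def)
  have "norm x \<le> K * norm_wrt A x" if x: "x \<in> closure (range A)" for x
  proof (cases "norm_wrt A x = 0")
    case True
    have "\<bar>t\<bar> * norm x \<le> K" for t
      using K[of "t *\<^sub>R x"] True subspace_scale[OF subspace_closure_range x] by (simp add: norm_wrt_scaleR)
    \<comment> \<open>The whole line through \<open>x\<close> lies in the bounded set. If
      \<open>x\<close> were nonzero, this multiple would have norm \<open>\<bar>K\<bar> + 1\<close>,
      which exceeds \<open>K\<close>.\<close>
    from this[of "(\<bar>K\<bar> + 1) / norm x"] have "norm x = 0" by (cases "norm x = 0") auto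
    then show ?thesis using True by simp
  next
    case False
    then have "norm (inverse (norm_wrt A x) *\<^sub>R x) \<le> K"
      using x by (intro K subspace_scale[OF subspace_closure_range]) (simp_all add: norm_wrt_scaleR)
    moreover have "norm_wrt A x > 0" using False by (simp add: less_le)
    ultimately show ?thesis by (simp add: field_simps)
  qed
  then show thesis by (rule that)
qed

section \<open>Convergence of maximizing sequences\<close>

lemma tendsto_norm_wrt:
  assumes "(f \<longlongrightarrow> x) F"
  shows "((\<lambda>n. norm_wrt A (f n)) \<longlongrightarrow> norm_wrt A x) F"
  unfolding norm_wrt_def cinner_wrt_def inner_eq_Re_cinner[symmetric]
  by (intro tendsto_intros tendsto assms)

text \<open>
  No weak compactness is needed: by the parallelogram law a maximizing sequence is Cauchy as soon
  as its image under \<open>T\<close> is.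
\<close>

lemma maximizing_sequence_converges:
  assumes bdd: "bounded (unit_ball_wrt A \<inter> closure (range A))"
    and T: "T \<in> bounded_operators_wrt A" "compact_operator T"
    and pos: "0 < opnorm_wrt A T"
    and f: "\<And>n. f n \<in> closure (range A)" "\<And>n. norm_wrt A (f n) = 1"
    and lim: "(\<lambda>n. norm_wrt A (T (f n))) \<longlonglongrightarrow> opnorm_wrt A T"
  obtains r x where "strict_mono r" "(f \<circ> r) \<longlonglongrightarrow> x"
proof -
  let ?N = "opnorm_wrt A T"
  interpret T: bounded_linear T by (rule bounded_operators_wrtD(1)[OF T(1)])
  obtain K where K: "\<And>x. x \<in> closure (range A) \<Longrightarrow> norm x \<le> K * norm_wrt A x"
    using norm_le_norm_wrt[OF bdd] by blast
  have "norm (f n) \<le> K" for n using K[OF f(1)] f(2) by simp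
  then have "bounded (range f)" unfolding bounded_iff by blast
  then have cpt: "compact (closure (T ` range f))" using T(2) by (simp add: compact_operator_def)
  have mem: "\<forall>n. T (f n) \<in> closure (T ` range f)"
    by (rule allI, rule subsetD[OF closure_subset], rule imageI, rule rangeI)
  obtain l r where "l \<in> closure (T ` range f)" and r: "strict_mono r" "((\<lambda>n. T (f n)) \<circ> r) \<longlonglongrightarrow> l"
    using seq_compactE[OF compact_imp_seq_compact[OF cpt] mem] .
  define g where "g = f \<circ> r"
  have g: "g n \<in> closure (range A)" "norm_wrt A (g n) = 1" for n
    using f by (auto simp: g_def)
  have Tg: "(\<lambda>n. T (g n)) \<longlonglongrightarrow> l" using r(2) by (simp add: g_def o_def)
  have Ng: "(\<lambda>n. norm_wrt A (T (g n))) \<longlonglongrightarrow> ?N"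
    using LIMSEQ_subseq_LIMSEQ[OF lim r(1)] by (simp add: g_def o_def)
  \<comment> \<open>The error of one index: how far \<open>g n\<close> is from attaining the
    operator seminorm, plus the distance of \<open>T (g n)\<close> from its limit. The factor undoes
    the \<open>?N\<^sup>2\<close> of the estimate below and passes from seminorm to norm via
    \<open>K\<close>.\<close>
  define b where
    "b n = K\<^sup>2 / ?N\<^sup>2 * (2 * (?N\<^sup>2 - (norm_wrt A (T (g n)))\<^sup>2) + 2 * (norm_wrt A (T (g n) - l))\<^sup>2)" for n
  have "b \<longlonglongrightarrow> K\<^sup>2 / ?N\<^sup>2 * (2 * (?N\<^sup>2 - ?N\<^sup>2) + 2 * (norm_wrt A (l - l))\<^sup>2)"
    unfolding b_def by (intro tendsto_intros tendsto_norm_wrt Tg Ng)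
  moreover have "norm_wrt A 0 = 0" by (simp add: norm_wrt_eq_0_iff)
  ultimately have b0: "b \<longlonglongrightarrow> 0" by simp
  have "(dist (g n) (g k))\<^sup>2 \<le> b n + b k" for n k
  proof -
    let ?d = "norm_wrt A (g n - g k)"
    \<comment> \<open>The operator bound is applied to the sum because, for unit vectors, the
      parallelogram law turns its square into \<open>4 - ?d\<^sup>2\<close>, which isolates the
      distance to be controlled.\<close>
    have "(norm_wrt A (T (g n + g k)))\<^sup>2 \<le> (?N * norm_wrt A (g n + g k))\<^sup>2"
      by (intro power_mono norm_wrt_le_opnorm T) simp
    also have "\<dots> = ?N\<^sup>2 * (4 - ?d\<^sup>2)"
      by (simp add: power_mult_distrib norm_wrt_add_sq norm_wrt_diff_sq g)
    finally have 1: "?N\<^sup>2 * ?d\<^sup>2 \<le> 4 * ?N\<^sup>2 - (norm_wrt A (T (g n + g k)))\<^sup>2"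
      by (simp add: algebra_simps)
    have 2: "(norm_wrt A (T (g n + g k)))\<^sup>2 = 2 * (norm_wrt A (T (g n)))\<^sup>2
        + 2 * (norm_wrt A (T (g k)))\<^sup>2 - (norm_wrt A (T (g n) - T (g k)))\<^sup>2"
      by (simp add: T.add norm_wrt_add_sq norm_wrt_diff_sq)
    have "0 \<le> (norm_wrt A ((T (g n) - l) + (T (g k) - l)))\<^sup>2" by simp
    then have 3: "(norm_wrt A (T (g n) - T (g k)))\<^sup>2
        \<le> 2 * (norm_wrt A (T (g n) - l))\<^sup>2 + 2 * (norm_wrt A (T (g k) - l))\<^sup>2"
      using norm_wrt_add_sq[of "T (g n) - l" "T (g k) - l"]
        norm_wrt_diff_sq[of "T (g n) - l" "T (g k) - l"] by simp
    from 1 2 3 have "?N\<^sup>2 * ?d\<^sup>2 \<le>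
        (2 * (?N\<^sup>2 - (norm_wrt A (T (g n)))\<^sup>2) + 2 * (norm_wrt A (T (g n) - l))\<^sup>2) +
        (2 * (?N\<^sup>2 - (norm_wrt A (T (g k)))\<^sup>2) + 2 * (norm_wrt A (T (g k) - l))\<^sup>2)"
      by argo
    from mult_left_mono[OF this, of "K\<^sup>2 / ?N\<^sup>2"] have d: "K\<^sup>2 * ?d\<^sup>2 \<le> b n + b k"
      unfolding b_def distrib_left[symmetric] using pos by simp
    have "norm (g n - g k) \<le> K * ?d" by (intro K subspace_diff[OF subspace_closure_range] g)
    then have "(norm (g n - g k))\<^sup>2 \<le> (K * ?d)\<^sup>2" by (rule power_mono) simp
    with d show ?thesis by (simp add: dist_norm power_mult_distrib)
  qed
  then have "Cauchy g" using b0 by (rule Cauchy_if_dist_sq_le)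
  then obtain x where "g \<longlonglongrightarrow> x" using Cauchy_convergent_iff convergent_def by blast
  with r(1) show thesis unfolding g_def by (rule that)
qed

section \<open>From approximate orthogonality to norm-attaining vectors\<close>

text \<open>A near-maximizer on the unit sphere is projected onto the closure of the range;
  \<open>A\<close> sends the old and new images under T + c S to the same vector, so no seminorm
  changes.\<close>

lemma near_maximizer_exists:
  assumes "A \<noteq> (\<lambda>x. 0)" "T \<in> bounded_operators_wrt A" "S \<in> bounded_operators_wrt A" "\<delta> > 0"
  obtains x where "x \<in> closure (range A)" "norm_wrt A x = 1"
    "(opnorm_wrt A (\<lambda>x. T x + c *\<^sub>C S x))\<^sup>2 - \<delta> \<le> (norm_wrt A (T x + c *\<^sub>C S x))\<^sup>2"
proof -
  let ?P = "\<lambda>x. T x + c *\<^sub>C S x"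
  obtain u where "norm_wrt A u = 1" using unit_vector_exists[OF assms(1)] .
  then have "0 \<le> opnorm_wrt A ?P"
    using norm_wrt_le_opnorm_add_scaleC[OF assms(2,3)] norm_wrt_nonneg order_trans by metis
  with opnorm_wrt_sq_least[OF assms(1), of ?P "(opnorm_wrt A ?P)\<^sup>2 - \<delta>"] assms(4)
  obtain z where z: "norm_wrt A z = 1" "(opnorm_wrt A ?P)\<^sup>2 - \<delta> \<le> (norm_wrt A (?P z))\<^sup>2"
    by (smt (verit))
  obtain x where x: "x \<in> closure (range A)" "A x = A z" using range_component_exists .
  have "A (?P x) = A (?P z)"
    using A_image_cong[OF assms(2) x(2)] A_image_cong[OF assms(3) x(2)] by (simp add: add scaleC)
  then show thesis using that[OF x(1)] z norm_wrt_cong[OF x(2)] norm_wrt_cong by metis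
qed

text \<open>The unit scalar \<open>u\<close> stands for a direction
  \<open>exp (\<i> * \<theta>)\<close>. Allowing all directions lets the same lemma produce both
  vectors of (ii).\<close>

lemma approx_orthogonal_imp_maximizer:
  assumes A: "A \<noteq> (\<lambda>x. 0)"
    and bdd: "bounded (unit_ball_wrt A \<inter> closure (range A))"
    and T: "T \<in> bounded_operators_wrt A" "compact_operator T"
    and S: "S \<in> bounded_operators_wrt A"
    and orth: "approx_orthogonal_wrt A \<epsilon> T S"
    and u: "cmod u = 1"
  obtains x where "norm_wrt A x = 1" "norm_wrt A (T x) = opnorm_wrt A T"
    "- (\<epsilon> * opnorm_wrt A T * opnorm_wrt A S) \<le> inner (A (T x)) (u *\<^sub>C S x)"
proof -
  let ?N = "opnorm_wrt A T" and ?s = "opnorm_wrt A S"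
  have N0: "0 \<le> ?N" and s0: "0 \<le> ?s" using opnorm_wrt_nonneg A T S by auto
  show thesis
  proof (cases "?N = 0")
    \<comment> \<open>Here \<open>A (T x) = 0\<close> for every unit vector, so any of them attains
      the operator seminorm and both sides of the inequality are 0.\<close>
    case True
    obtain x where x: "norm_wrt A x = 1" using unit_vector_exists[OF A] .
    then have "norm_wrt A (T x) = 0"
      using norm_wrt_le_opnorm_unit[OF T(1) x] True norm_wrt_nonneg[of "T x"] by linarith
    then have "A (T x) = 0" by (simp add: norm_wrt_eq_0_iff)
    then show thesis using that[OF x] True \<open>norm_wrt A (T x) = 0\<close> by simp
  next
    case False
    then have pos: "0 < ?N" using N0 by simp
    define t :: "nat \<Rightarrow> real" where "t n = inverse (real (Suc n))" for n
    have t: "t n > 0" "t \<longlonglongrightarrow> 0" for n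
      unfolding t_def using LIMSEQ_inverse_real_of_nat by auto
    define G where "G x = inner (A (T x)) (u *\<^sub>C S x)" for x
    \<comment> \<open>Orthogonality is used at the scalar \<open>t n * u\<close>, and
      \<open>G\<close> is the first-order coefficient of the expansion. The slack
      \<open>(t n)\<^sup>2\<close> is of second order and so vanishes in the limit after division by
      \<open>2 * t n\<close>.\<close>
    have "\<exists>x. x \<in> closure (range A) \<and> norm_wrt A x = 1 \<and>
        ?N\<^sup>2 - 2 * \<epsilon> * t n * ?N * ?s - (t n)\<^sup>2 \<le> (norm_wrt A (T x))\<^sup>2 + 2 * t n * G x + (t n)\<^sup>2 * ?s\<^sup>2" for n
    proof -
      let ?c = "of_real (t n) * u"
      have c: "cmod ?c = t n" using u t(1)[of n] by (simp add: norm_mult)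
      obtain x where x: "x \<in> closure (range A)" "norm_wrt A x = 1"
        "(opnorm_wrt A (\<lambda>x. T x + ?c *\<^sub>C S x))\<^sup>2 - (t n)\<^sup>2 \<le> (norm_wrt A (T x + ?c *\<^sub>C S x))\<^sup>2"
        using near_maximizer_exists[OF A T(1) S, of "(t n)\<^sup>2" ?c] t(1)[of n] by auto
      have "?N\<^sup>2 - 2 * \<epsilon> * ?N * (t n * ?s) \<le> (opnorm_wrt A (\<lambda>x. T x + ?c *\<^sub>C S x))\<^sup>2"
        using orth unfolding approx_orthogonal_wrt_def opnorm_wrt_scaleC[OF A S] by (metis c)
      moreover have "?c *\<^sub>C S x = t n *\<^sub>R (u *\<^sub>C S x)"
        by (simp only: scaleR_scaleC scaleC_scaleC)
      moreover have "(norm_wrt A (u *\<^sub>C S x))\<^sup>2 \<le> ?s\<^sup>2"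
        using norm_wrt_le_opnorm_unit[OF S x(2)] u by (simp add: norm_wrt_scaleC power_mono)
      then have "(norm_wrt A (t n *\<^sub>R (u *\<^sub>C S x)))\<^sup>2 \<le> (t n)\<^sup>2 * ?s\<^sup>2"
        by (simp add: norm_wrt_scaleR power_mult_distrib mult_left_mono)
      ultimately show ?thesis
        using x norm_wrt_add_sq[of "T x" "t n *\<^sub>R (u *\<^sub>C S x)"]
        by (intro exI[of _ x]) (simp add: G_def algebra_simps)
    qed
    then obtain f where f: "\<And>n. f n \<in> closure (range A)" "\<And>n. norm_wrt A (f n) = 1"
      and ineq: "\<And>n. ?N\<^sup>2 - 2 * \<epsilon> * t n * ?N * ?s - (t n)\<^sup>2
        \<le> (norm_wrt A (T (f n)))\<^sup>2 + 2 * t n * G (f n) + (t n)\<^sup>2 * ?s\<^sup>2"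
      by metis
    have TN: "norm_wrt A (T (f n)) \<le> ?N" for n by (rule norm_wrt_le_opnorm_unit[OF T(1) f(2)])
    have GN: "G (f n) \<le> ?N * ?s" for n
    proof -
      have "G (f n) \<le> norm_wrt A (T (f n)) * norm_wrt A (u *\<^sub>C S (f n))"
        unfolding G_def using Cauchy_Schwarz_wrt abs_le_D1 by blast
      also have "\<dots> \<le> ?N * ?s"
        using TN[of n] norm_wrt_le_opnorm_unit[OF S f(2)] u N0
        by (intro mult_mono) (simp_all add: norm_wrt_scaleC)
      finally show ?thesis .
    qed
    \<comment> \<open>\<open>?N\<^sup>2\<close> cancels against the bound for
      \<open>T (f n)\<close>, and dividing by \<open>2 * t n\<close> leaves an error with 1 from the
      slack and \<open>?s\<^sup>2\<close> from the quadratic term.\<close>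
    have lower: "- (\<epsilon> * ?N * ?s) - t n * ((1 + ?s\<^sup>2) / 2) \<le> G (f n)" for n
    proof -
      have eq: "(2 * t n) * (G (f n) + \<epsilon> * ?N * ?s + t n * ((1 + ?s\<^sup>2) / 2))
          = 2 * t n * G (f n) + 2 * \<epsilon> * t n * ?N * ?s + (t n)\<^sup>2 + (t n)\<^sup>2 * ?s\<^sup>2"
        by (simp add: field_simps power2_eq_square)
      have "(norm_wrt A (T (f n)))\<^sup>2 \<le> ?N\<^sup>2" by (intro power_mono TN) simp
      with ineq[of n] have "0 \<le> (2 * t n) * (G (f n) + \<epsilon> * ?N * ?s + t n * ((1 + ?s\<^sup>2) / 2))"
        unfolding eq by linarith
      then show ?thesis using t(1)[of n] by (simp add: zero_le_mult_iff)
    qed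
    \<comment> \<open>As \<open>G\<close> is bounded above by \<open>?N * ?s\<close>, every
      correction in \<open>ineq\<close> tends to 0, so \<open>f\<close> is a maximizing sequence for
      \<open>T\<close> itself.\<close>
    have "(\<lambda>n. (norm_wrt A (T (f n)))\<^sup>2) \<longlonglongrightarrow> ?N\<^sup>2"
    proof (rule tendsto_sandwich)
      show "\<forall>\<^sub>F n in sequentially. (norm_wrt A (T (f n)))\<^sup>2 \<le> ?N\<^sup>2"
        by (intro always_eventually allI power_mono TN) simp
      have "?N\<^sup>2 - 2 * \<epsilon> * t n * ?N * ?s - (t n)\<^sup>2 - 2 * t n * (?N * ?s) - (t n)\<^sup>2 * ?s\<^sup>2
          \<le> (norm_wrt A (T (f n)))\<^sup>2" for n
        using ineq[of n] mult_left_mono[OF GN[of n], of "2 * t n"] t(1)[of n] by linarith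
      then show "\<forall>\<^sub>F n in sequentially.
          ?N\<^sup>2 - 2 * \<epsilon> * t n * ?N * ?s - (t n)\<^sup>2 - 2 * t n * (?N * ?s) - (t n)\<^sup>2 * ?s\<^sup>2
          \<le> (norm_wrt A (T (f n)))\<^sup>2" by simp
      have "(\<lambda>n. ?N\<^sup>2 - 2 * \<epsilon> * t n * ?N * ?s - (t n)\<^sup>2 - 2 * t n * (?N * ?s) - (t n)\<^sup>2 * ?s\<^sup>2)
          \<longlonglongrightarrow> ?N\<^sup>2 - 2 * \<epsilon> * 0 * ?N * ?s - 0\<^sup>2 - 2 * 0 * (?N * ?s) - 0\<^sup>2 * ?s\<^sup>2"
        by (intro tendsto_intros t(2))
      then show "(\<lambda>n. ?N\<^sup>2 - 2 * \<epsilon> * t n * ?N * ?s - (t n)\<^sup>2 - 2 * t n * (?N * ?s) - (t n)\<^sup>2 * ?s\<^sup>2)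
          \<longlonglongrightarrow> ?N\<^sup>2" by simp
    qed simp
    from tendsto_real_sqrt[OF this] have lim: "(\<lambda>n. norm_wrt A (T (f n))) \<longlonglongrightarrow> ?N"
      using N0 by simp
    obtain r x where r: "strict_mono r" and x: "(f \<circ> r) \<longlonglongrightarrow> x"
      using maximizing_sequence_converges[OF bdd T pos f lim] .
    have Tx: "(\<lambda>n. T ((f \<circ> r) n)) \<longlonglongrightarrow> T x" and Sx: "(\<lambda>n. S ((f \<circ> r) n)) \<longlonglongrightarrow> S x"
      using bounded_linear.tendsto[OF _ x] bounded_operators_wrtD(1) T S by auto
    have "norm_wrt A x = 1"
      using tendsto_norm_wrt[OF x] LIMSEQ_unique[OF _ tendsto_const] by (simp add: f)
    moreover have "norm_wrt A (T x) = ?N"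
      using LIMSEQ_unique[OF tendsto_norm_wrt[OF Tx]] LIMSEQ_subseq_LIMSEQ[OF lim r]
      by (simp add: o_def)
    moreover have "- (\<epsilon> * ?N * ?s) \<le> G x"
    proof (rule tendsto_le[OF sequentially_bot])
      show "(\<lambda>n. G ((f \<circ> r) n)) \<longlonglongrightarrow> G x"
        unfolding G_def
        by (intro tendsto_intros tendsto Tx bounded_linear.tendsto[OF bounded_linear_scaleC] Sx)
      have "(\<lambda>n. - (\<epsilon> * ?N * ?s) - t (r n) * ((1 + ?s\<^sup>2) / 2)) \<longlonglongrightarrow> - (\<epsilon> * ?N * ?s) - 0 * ((1 + ?s\<^sup>2) / 2)"
        using LIMSEQ_subseq_LIMSEQ[OF t(2) r] by (intro tendsto_intros) (simp_all add: o_def)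
      then show "(\<lambda>n. - (\<epsilon> * ?N * ?s) - t (r n) * ((1 + ?s\<^sup>2) / 2)) \<longlonglongrightarrow> - (\<epsilon> * ?N * ?s)" by simp
      show "\<forall>\<^sub>F n in sequentially. - (\<epsilon> * ?N * ?s) - t (r n) * ((1 + ?s\<^sup>2) / 2) \<le> G ((f \<circ> r) n)"
        using lower by simp
    qed
    ultimately show thesis unfolding G_def by (rule that)
  qed
qed

section \<open>From norm-attaining vectors to approximate orthogonality\<close>

text \<open>The square is expanded at the norm-attaining vector \<open>x\<close> and the nonnegative
  term of \<open>c *\<^sub>C S x\<close> is dropped.\<close>

lemma opnorm_wrt_add_scaleC_lower:
  assumes A: "A \<noteq> (\<lambda>x. 0)"
    and T: "T \<in> bounded_operators_wrt A" and S: "S \<in> bounded_operators_wrt A"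
    and x: "norm_wrt A x = 1" "norm_wrt A (T x) = opnorm_wrt A T"
    and le: "- q \<le> inner (A (T x)) (c *\<^sub>C S x)"
  shows "(opnorm_wrt A T)\<^sup>2 - 2 * q \<le> (opnorm_wrt A (\<lambda>x. T x + c *\<^sub>C S x))\<^sup>2"
proof -
  have "(opnorm_wrt A T)\<^sup>2 - 2 * q \<le> (norm_wrt A (T x + c *\<^sub>C S x))\<^sup>2"
    unfolding norm_wrt_add_sq x(2)
    using le zero_le_power2[of "norm_wrt A (c *\<^sub>C S x)"] by linarith
  also have "\<dots> \<le> (opnorm_wrt A (\<lambda>x. T x + c *\<^sub>C S x))\<^sup>2"
    by (intro power_mono norm_wrt_le_opnorm_add_scaleC[OF T S x(1)]) simp
  finally show ?thesis .
qed

text \<open>Translates the real form of the estimates into conditions (b) and (c); the sign of the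
  exponent flips by conjugate linearity in the second argument.\<close>

lemma inner_eq_Re_exp:
  "inner (A x) (exp (\<i> * complex_of_real \<theta>) *\<^sub>C y)
    = Re (exp (- (\<i> * complex_of_real \<theta>)) * cinner_wrt A x y)"
  by (simp add: inner_eq_Re_cinner cinner_scaleC_right cinner_wrt_def exp_cnj)

end

theorem theorem2p13:
  fixes A T S :: "'a::chilbert_space \<Rightarrow> 'a" and \<epsilon> :: real
  assumes "positive_operator A"
    and "A \<noteq> (\<lambda>x. 0)"
    and "0 \<le> \<epsilon>" and "\<epsilon> < 1"
    and "bounded (unit_ball_wrt A \<inter> closure (range A))"
    and "T \<in> bounded_operators_wrt A" and "compact_operator T"
    and "S \<in> bounded_operators_wrt A" and "compact_operator S"
  shows "approx_orthogonal_wrt A \<epsilon> T S \<longleftrightarrow>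
    (\<forall>\<theta>::real. 0 \<le> \<theta> \<and> \<theta> < pi \<longrightarrow>
      (\<exists>x \<in> unit_sphere_wrt A. \<exists>y \<in> unit_sphere_wrt A.
        (norm_wrt A (T x) = opnorm_wrt A T \<and> norm_wrt A (T y) = opnorm_wrt A T) \<and>
        Re (exp (- (\<i> * complex_of_real \<theta>)) * cinner_wrt A (T x) (S x))
          \<ge> - (\<epsilon> * opnorm_wrt A T * opnorm_wrt A S) \<and>
        Re (exp (- (\<i> * complex_of_real \<theta>)) * cinner_wrt A (T y) (S y))
          \<le> \<epsilon> * opnorm_wrt A T * opnorm_wrt A S))"
proof
  interpret positive_op A by standard (rule assms(1))
  let ?N = "opnorm_wrt A T" and ?s = "opnorm_wrt A S"
  let ?R = "\<lambda>\<theta> x. Re (exp (- (\<i> * complex_of_real \<theta>)) * cinner_wrt A (T x) (S x))"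
  {
    assume orth: "approx_orthogonal_wrt A \<epsilon> T S"
    have *: "\<exists>x\<in>unit_sphere_wrt A. norm_wrt A (T x) = ?N \<and> - (\<epsilon> * ?N * ?s) \<le> ?R \<theta> x" for \<theta>
      using approx_orthogonal_imp_maximizer[OF assms(2,5,6,7,8) orth, of "exp (\<i> * complex_of_real \<theta>)"]
      unfolding inner_eq_Re_exp unit_sphere_wrt_def by auto
    \<comment> \<open>The lower bound at \<open>\<theta> + pi\<close> is thereby the upper bound
      required of \<open>y\<close> at \<open>\<theta>\<close>.\<close>
    have shift: "?R (\<theta> + pi) x = - ?R \<theta> x" for \<theta> x
      by (simp add: distrib_left exp_diff exp_add exp_minus)
    show "\<forall>\<theta>. 0 \<le> \<theta> \<and> \<theta> < pi \<longrightarrow> (\<exists>x\<in>unit_sphere_wrt A. \<exists>y\<in>unit_sphere_wrt A.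
      (norm_wrt A (T x) = ?N \<and> norm_wrt A (T y) = ?N) \<and>
      ?R \<theta> x \<ge> - (\<epsilon> * ?N * ?s) \<and> ?R \<theta> y \<le> \<epsilon> * ?N * ?s)"
    proof (intro allI impI)
      fix \<theta> :: real
      show "\<exists>x\<in>unit_sphere_wrt A. \<exists>y\<in>unit_sphere_wrt A.
        (norm_wrt A (T x) = ?N \<and> norm_wrt A (T y) = ?N) \<and>
        ?R \<theta> x \<ge> - (\<epsilon> * ?N * ?s) \<and> ?R \<theta> y \<le> \<epsilon> * ?N * ?s"
        using *[of \<theta>] *[of "\<theta> + pi"] unfolding shift neg_le_iff_le by blast
    qed
  next
    assume R: "\<forall>\<theta>. 0 \<le> \<theta> \<and> \<theta> < pi \<longrightarrow> (\<exists>x\<in>unit_sphere_wrt A. \<exists>y\<in>unit_sphere_wrt A.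
      (norm_wrt A (T x) = ?N \<and> norm_wrt A (T y) = ?N) \<and>
      ?R \<theta> x \<ge> - (\<epsilon> * ?N * ?s) \<and> ?R \<theta> y \<le> \<epsilon> * ?N * ?s)"
    show "approx_orthogonal_wrt A \<epsilon> T S"
      unfolding approx_orthogonal_wrt_def opnorm_wrt_scaleC[OF assms(2,8)]
    proof
      fix c
      \<comment> \<open>The argument of \<open>c\<close> is folded into the interval from 0 to
        \<open>pi\<close> covered by (ii), and \<open>\<sigma>\<close> records the sign lost in
        folding.\<close>
      define \<theta> where "\<theta> = (if Arg2pi c < pi then Arg2pi c else Arg2pi c - pi)"
      define \<sigma> :: real where "\<sigma> = (if Arg2pi c < pi then 1 else - 1)"
      have \<theta>: "0 \<le> \<theta>" "\<theta> < pi"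
        using Arg2pi_ge_0[of c] Arg2pi_lt_2pi[of c] by (auto simp: \<theta>_def)
      have "exp (\<i> * complex_of_real (Arg2pi c)) = of_real \<sigma> * exp (\<i> * complex_of_real \<theta>)"
        by (simp add: \<theta>_def \<sigma>_def right_diff_distrib exp_diff)
      then have c: "c = of_real (cmod c * \<sigma>) * exp (\<i> * complex_of_real \<theta>)"
        using Arg2pi_eq[of c] by (simp add: mult.assoc)
      have inner: "inner (A (T x)) (c *\<^sub>C S x) = cmod c * (\<sigma> * ?R \<theta> x)" for x
      proof -
        have "c *\<^sub>C S x = (cmod c * \<sigma>) *\<^sub>R (exp (\<i> * complex_of_real \<theta>) *\<^sub>C S x)"
          unfolding scaleR_scaleC scaleC_scaleC c[symmetric] by (rule refl)
        then show ?thesis by (simp add: inner_eq_Re_exp)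
      qed
      \<comment> \<open>Sign 1 takes the first vector of (ii) with (b); sign -1 takes the second
        with (c) negated.\<close>
      obtain x where x: "norm_wrt A x = 1" "norm_wrt A (T x) = ?N" "- (\<epsilon> * ?N * ?s) \<le> \<sigma> * ?R \<theta> x"
      proof -
        obtain x y where xy: "norm_wrt A x = 1" "norm_wrt A y = 1"
          "norm_wrt A (T x) = ?N" "norm_wrt A (T y) = ?N"
          "- (\<epsilon> * ?N * ?s) \<le> ?R \<theta> x" "?R \<theta> y \<le> \<epsilon> * ?N * ?s"
          using R \<theta> unfolding unit_sphere_wrt_def by blast
        show thesis
        proof (cases "Arg2pi c < pi")
          case True
          show thesis by (rule that[OF xy(1,3)]) (use True xy(5) in \<open>simp add: \<sigma>_def\<close>)
        next
          case False
          show thesis by (rule that[OF xy(2,4)]) (use False xy(6) in \<open>simp add: \<sigma>_def\<close>)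
        qed
      qed
      have "cmod c * - (\<epsilon> * ?N * ?s) \<le> inner (A (T x)) (c *\<^sub>C S x)"
        unfolding inner by (intro mult_left_mono x) simp
      then show "?N\<^sup>2 - 2 * \<epsilon> * ?N * (cmod c * ?s) \<le> (opnorm_wrt A (\<lambda>x. T x + c *\<^sub>C S x))\<^sup>2"
        using opnorm_wrt_add_scaleC_lower[OF assms(2,6,8) x(1,2), of "cmod c * (\<epsilon> * ?N * ?s)" c]
        by (simp add: mult_ac)
    qed
  }
qed

end
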